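(* Let $\mathfrak{A}$ be a residuated lattice. The following assertions are equivalent: (1) $\mathfrak{A}$ is quasicomplemented and weakly disjunctive; (2) $\mathscr{PF}(\mathfrak{A})$ is a Boolean lattice.
   Context: A residuated lattice $\mathfrak{A}=(A;\vee,\wedge,\odot,\rightarrow,0,1)$ is an algebra such that $(A;\vee,\wedge,0,1)$ is a bounded lattice, $(A;\odot,1)$ is a commutative monoid, and $x\odot y\leq z$ iff $x\leq y\rightarrow z$. A filter is a non-empty $F\subseteq A$ closed under $\odot$ and such that $x\in F$, $y\in A$ imply $x\vee y\in F$. $\mathscr{F}(x)$ is the filter generated by $x$ (a principal filter), and $\mathscr{PF}(\mathfrak{A})=\{\mathscr{F}(x)\mid x\in A\}$ is the lattice of principal filters, ordered by inclusion, a sublattice of the lattice of all filters: $\mathscr{F}(x)\cap\mathscr{F}(y)=\mathscr{F}(x\vee y)$ and the join is $\mathscr{F}(x\odot y)$; its bounds are $\{1\}=\mathscr{F}(1)$ and $A=\mathscr{F}(0)$. For $X\subseteq A$, $X^{\perp}=\{a\in A\mid a\vee x=1\ \forall x\in X\}$; $x^{\perp}:=\{x\}^{\perp}$ and $x^{\perp\perp}:=(x^{\perp})^{\perp}$. $\mathfrak{A}$ is quasicomplemented if for every $x\in A$ there is $y\in A$ with $x^{\perp\perp}=y^{\perp}$. $\mathfrak{A}$ is weakly disjunctive if the (well-defined) map $\mathscr{F}(x)\mapsto x^{\perp}$ is injective, i.e. $x^{\perp}=y^{\perp}$ implies $\mathscr{F}(x)=\mathscr{F}(y)$. *)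

theory Defs
  imports "HOL-Algebra.Lattice" "HOL-Algebra.Group"
begin

text \<open>
  The lattice operations and the constants \<open>0\<close>, \<open>1\<close> are those derived from the order of the
  underlying \<open>gorder\<close>: \<open>\<squnion>\<close>, \<open>\<sqinter>\<close>, \<open>\<bottom>\<close>, \<open>\<top>\<close>.
\<close>

record 'a residuated = "'a gorder" +
  tensor :: "'a \<Rightarrow> 'a \<Rightarrow> 'a"  (infixl \<open>\<odot>\<index>\<close> 72)
  residuum :: "'a \<Rightarrow> 'a \<Rightarrow> 'a"  (infixr \<open>\<rightharpoonup>\<index>\<close> 62)

locale residuated_lattice = bounded_lattice L for L (structure) +
  assumes tensor_comm_monoid: "comm_monoid \<lparr>carrier = carrier L, mult = (\<odot>), one = \<top>\<rparr>"
    and residuum_closed: "\<lbrakk>x \<in> carrier L; y \<in> carrier L\<rbrakk> \<Longrightarrow> x \<rightharpoonup> y \<in> carrier L"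
    and residuation: "\<lbrakk>x \<in> carrier L; y \<in> carrier L; z \<in> carrier L\<rbrakk>
      \<Longrightarrow> x \<odot> y \<sqsubseteq> z \<longleftrightarrow> x \<sqsubseteq> y \<rightharpoonup> z"

definition rl_filter :: "('a, 'b) residuated_scheme \<Rightarrow> 'a set \<Rightarrow> bool" where
  "rl_filter L F \<longleftrightarrow> F \<subseteq> carrier L \<and> F \<noteq> {}
    \<and> (\<forall>x\<in>F. \<forall>y\<in>F. x \<odot>\<^bsub>L\<^esub> y \<in> F)
    \<and> (\<forall>x\<in>F. \<forall>y\<in>carrier L. x \<squnion>\<^bsub>L\<^esub> y \<in> F)"

definition principal_filter :: "('a, 'b) residuated_scheme \<Rightarrow> 'a \<Rightarrow> 'a set" where
  "principal_filter L x = \<Inter> {F. rl_filter L F \<and> x \<in> F}"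

text \<open>Joins and meets in this structure are taken inside the poset of principal filters.\<close>

definition principal_filters :: "('a, 'b) residuated_scheme \<Rightarrow> 'a set gorder" where
  "principal_filters L =
    \<lparr>carrier = principal_filter L ` carrier L, eq = (=), le = (\<subseteq>)\<rparr>"

definition coannihilator :: "('a, 'b) residuated_scheme \<Rightarrow> 'a set \<Rightarrow> 'a set" where
  "coannihilator L X = {a \<in> carrier L. \<forall>x\<in>X. a \<squnion>\<^bsub>L\<^esub> x = \<top>\<^bsub>L\<^esub>}"

definition quasicomplemented :: "('a, 'b) residuated_scheme \<Rightarrow> bool" where
  "quasicomplemented L \<longleftrightarrow> (\<forall>x\<in>carrier L. \<exists>y\<in>carrier L.
    coannihilator L (coannihilator L {x}) = coannihilator L {y})"

definition weakly_disjunctive :: "('a, 'b) residuated_scheme \<Rightarrow> bool" where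
  "weakly_disjunctive L \<longleftrightarrow> (\<forall>x\<in>carrier L. \<forall>y\<in>carrier L.
    coannihilator L {x} = coannihilator L {y} \<longrightarrow> principal_filter L x = principal_filter L y)"

locale boolean_lattice = bounded_lattice L for L (structure) +
  assumes meet_join_distrib: "\<lbrakk>x \<in> carrier L; y \<in> carrier L; z \<in> carrier L\<rbrakk>
      \<Longrightarrow> x \<sqinter> (y \<squnion> z) = (x \<sqinter> y) \<squnion> (x \<sqinter> z)"
    and complemented: "x \<in> carrier L \<Longrightarrow> \<exists>y\<in>carrier L. x \<sqinter> y = \<bottom> \<and> x \<squnion> y = \<top>"

end

theory Submission
  imports Defs
begin

text \<open>
  For a filter \<open>F\<close> and an element \<open>a\<close> the set of all \<open>b\<close> with \<open>a \<squnion> b \<in> F\<close> is again a filter,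
  because \<open>(a \<squnion> b) \<odot> (a \<squnion> c) \<sqsubseteq> a \<squnion> b \<odot> c\<close>. Hence meets and joins of principal filters are
  generated by \<open>x \<squnion> y\<close> and \<open>x \<odot> y\<close>, and the lattice they form is distributive.
  So \<open>\<F>(y)\<close> is a complement of \<open>\<F>(x)\<close> iff \<open>x \<squnion> y = \<top>\<close> and \<open>\<F>(x \<odot> y)\<close> is everything. If
  \<open>x\<^sup>\<bottom>\<^sup>\<bottom> = y\<^sup>\<bottom>\<close>, the first holds since \<open>x \<in> x\<^sup>\<bottom>\<^sup>\<bottom>\<close>, and the second follows from weak
  disjunctivity since \<open>(x \<odot> y)\<^sup>\<bottom> = x\<^sup>\<bottom> \<inter> x\<^sup>\<bottom>\<^sup>\<bottom> = {\<top>}\<close> is also the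
  coannihilator of the least element. Conversely, if \<open>\<F>(y)\<close> is a
  complement of \<open>\<F>(x)\<close> then \<open>x\<^sup>\<bottom> = \<F>(y)\<close> and \<open>y\<^sup>\<bottom> = \<F>(x)\<close>, which gives both properties.
\<close>

context residuated_lattice
begin

section \<open>Arithmetic of \<open>\<odot>\<close> and \<open>\<squnion>\<close>\<close>

lemma tensor_closed [simp]: "x \<in> carrier L \<Longrightarrow> y \<in> carrier L \<Longrightarrow> x \<odot> y \<in> carrier L"
  using comm_monoid.axioms(1)[OF tensor_comm_monoid] monoid.m_closed by fastforce

lemma tensor_comm: "x \<in> carrier L \<Longrightarrow> y \<in> carrier L \<Longrightarrow> x \<odot> y = y \<odot> x"
  using comm_monoid.m_comm[OF tensor_comm_monoid] by simp

lemma top_tensor [simp]: "x \<in> carrier L \<Longrightarrow> \<top> \<odot> x = x"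
  using comm_monoid.axioms(1)[OF tensor_comm_monoid] monoid.l_one by fastforce

text \<open>Residuation turns both inequalities into \<open>z \<rightharpoonup> w\<close> being an
  upper bound of \<open>x\<close> and \<open>y\<close>.\<close>

lemma join_tensor_le:
  assumes "x \<in> carrier L" "y \<in> carrier L" "z \<in> carrier L" "w \<in> carrier L"
    and "x \<odot> z \<sqsubseteq> w" "y \<odot> z \<sqsubseteq> w"
  shows "(x \<squnion> y) \<odot> z \<sqsubseteq> w"
  using assms by (simp add: residuation residuum_closed join_le)

text \<open>The unit of \<open>\<odot>\<close> is also the greatest element, so
  \<open>\<top> \<odot> y \<sqsubseteq> y\<close> puts \<open>y \<rightharpoonup> y\<close> above
  everything.\<close>

lemma tensor_le_right:
  assumes "x \<in> carrier L" "y \<in> carrier L"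
  shows "x \<odot> y \<sqsubseteq> y"
proof -
  have "\<top> \<sqsubseteq> y \<rightharpoonup> y"
    using residuation[of \<top> y y] assms by simp
  then have "x \<sqsubseteq> y \<rightharpoonup> y"
    using assms by (meson le_trans residuum_closed top_closed top_higher)
  then show ?thesis
    using assms by (simp add: residuation)
qed

lemma tensor_le_left: "x \<in> carrier L \<Longrightarrow> y \<in> carrier L \<Longrightarrow> x \<odot> y \<sqsubseteq> x"
  using tensor_le_right[of y x] by (simp add: tensor_comm)

text \<open>When the left side is multiplied out, every term except \<open>b \<odot> c\<close> has a
  factor \<open>a\<close> and so lies below \<open>a\<close>.\<close>

lemma join_tensor_join_le:
  assumes a: "a \<in> carrier L" and b: "b \<in> carrier L" and c: "c \<in> carrier L"
  shows "(a \<squnion> b) \<odot> (a \<squnion> c) \<sqsubseteq> a \<squnion> b \<odot> c"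
proof (rule join_tensor_le)
  show "a \<odot> (a \<squnion> c) \<sqsubseteq> a \<squnion> b \<odot> c"
    using a b c by (meson join_closed join_left le_trans tensor_closed tensor_le_left)
  have "(a \<squnion> c) \<odot> b \<sqsubseteq> a \<squnion> b \<odot> c"
  proof (rule join_tensor_le)
    show "a \<odot> b \<sqsubseteq> a \<squnion> b \<odot> c"
      using a b c by (meson join_closed join_left le_trans tensor_closed tensor_le_left)
    show "c \<odot> b \<sqsubseteq> a \<squnion> b \<odot> c"
      using a b c tensor_comm[of c b] join_right by simp
  qed (use a b c in simp_all)
  then show "b \<odot> (a \<squnion> c) \<sqsubseteq> a \<squnion> b \<odot> c"
    using a b c by (simp add: tensor_comm)
qed (use assms in simp_all)

lemma join_idem: "x \<in> carrier L \<Longrightarrow> x \<squnion> x = x"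
  using le_iff_meet[of x x] by simp

lemma join_top [simp]: "x \<in> carrier L \<Longrightarrow> x \<squnion> \<top> = \<top>"
  using le_iff_meet[of x \<top>] by simp

lemma join_bottom [simp]: "x \<in> carrier L \<Longrightarrow> x \<squnion> \<bottom> = x"
  using le_iff_meet[of \<bottom> x] by (simp add: join_comm[of L \<bottom>])

lemma join_eq_topI:
  assumes "x \<sqsubseteq> y" "a \<squnion> x = \<top>" "a \<in> carrier L" "x \<in> carrier L" "y \<in> carrier L"
  shows "a \<squnion> y = \<top>"
proof -
  have "a \<squnion> x \<sqsubseteq> a \<squnion> y"
    using assms by (intro join_le) (auto intro: join_left join_right le_trans)
  then show ?thesis
    using assms by (intro top_eq) (auto intro: le_trans[OF top_higher])
qed

text \<open>One direction is monotonicity; the other is \<open>join_tensor_join_le\<close> with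
  \<open>\<top> \<odot> \<top> = \<top>\<close>. It makes the coannihilator of a product the
  intersection of those of its factors.\<close>

lemma join_tensor_eq_top_iff:
  assumes "a \<in> carrier L" "x \<in> carrier L" "y \<in> carrier L"
  shows "a \<squnion> x \<odot> y = \<top> \<longleftrightarrow> a \<squnion> x = \<top> \<and> a \<squnion> y = \<top>"
proof
  assume "a \<squnion> x \<odot> y = \<top>"
  then show "a \<squnion> x = \<top> \<and> a \<squnion> y = \<top>"
    using join_eq_topI[of "x \<odot> y" _ a] tensor_le_left tensor_le_right assms by simp
next
  assume "a \<squnion> x = \<top> \<and> a \<squnion> y = \<top>"
  then have "\<top> \<sqsubseteq> a \<squnion> x \<odot> y"
    using join_tensor_join_le[of a x y] assms by simp
  then show "a \<squnion> x \<odot> y = \<top>"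
    using assms by (intro le_antisym) simp_all
qed

section \<open>Filters and coannihilators\<close>

lemma filter_carrier: "rl_filter L F \<Longrightarrow> x \<in> F \<Longrightarrow> x \<in> carrier L"
  by (auto simp: rl_filter_def)

lemma filter_tensor: "rl_filter L F \<Longrightarrow> x \<in> F \<Longrightarrow> y \<in> F \<Longrightarrow> x \<odot> y \<in> F"
  by (auto simp: rl_filter_def)

lemma filter_upward: "rl_filter L F \<Longrightarrow> x \<in> F \<Longrightarrow> x \<sqsubseteq> y \<Longrightarrow> y \<in> carrier L \<Longrightarrow> y \<in> F"
  unfolding rl_filter_def using le_iff_meet by (metis subsetD)

lemma filter_top: "rl_filter L F \<Longrightarrow> \<top> \<in> F"
  by (metis all_not_in_conv filter_carrier filter_upward rl_filter_def top_closed top_higher)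

text \<open>Upward closure yields the closure under joins in \<open>rl_filter\<close>, since
  \<open>x \<sqsubseteq> x \<squnion> y\<close>.\<close>

lemma filterI:
  assumes "F \<subseteq> carrier L" "\<top> \<in> F"
    and "\<And>x y. x \<in> F \<Longrightarrow> y \<in> F \<Longrightarrow> x \<odot> y \<in> F"
    and "\<And>x y. x \<in> F \<Longrightarrow> y \<in> carrier L \<Longrightarrow> x \<sqsubseteq> y \<Longrightarrow> y \<in> F"
  shows "rl_filter L F"
  unfolding rl_filter_def
proof (intro conjI ballI)
  show "x \<squnion> y \<in> F" if "x \<in> F" "y \<in> carrier L" for x y
    using that assms(1) by (intro assms(4)[OF that(1)]) (auto intro: join_left)
qed (use assms in auto)

lemma filter_carrier_self: "rl_filter L (carrier L)"
  by (rule filterI) simp_all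

lemma filter_top_singleton: "rl_filter L {\<top>}"
  by (rule filterI) (auto intro: le_antisym)

lemma filter_join_preimage:
  assumes F: "rl_filter L F" and a: "a \<in> carrier L"
  shows "rl_filter L {b \<in> carrier L. a \<squnion> b \<in> F}"
proof (rule filterI)
  show "\<top> \<in> {b \<in> carrier L. a \<squnion> b \<in> F}"
    using F a by (simp add: filter_top)
next
  fix x y assume x: "x \<in> {b \<in> carrier L. a \<squnion> b \<in> F}" and y: "y \<in> {b \<in> carrier L. a \<squnion> b \<in> F}"
  then have "a \<squnion> x \<odot> y \<in> F"
    using F a by (auto intro: filter_upward[OF F filter_tensor[OF F]] join_tensor_join_le)
  then show "x \<odot> y \<in> {b \<in> carrier L. a \<squnion> b \<in> F}"
    using x y by simp
next
  fix x y assume x: "x \<in> {b \<in> carrier L. a \<squnion> b \<in> F}" and y: "y \<in> carrier L" "x \<sqsubseteq> y"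
  then have "a \<squnion> x \<sqsubseteq> a \<squnion> y"
    using a by (intro join_le) (auto intro: join_left join_right le_trans)
  then show "y \<in> {b \<in> carrier L. a \<squnion> b \<in> F}"
    using x y a by (auto intro: filter_upward[OF F])
qed blast

lemma coannihilator_commuted: "coannihilator L X = {a \<in> carrier L. \<forall>x\<in>X. x \<squnion> a = \<top>}"
  by (subst join_comm) (rule coannihilator_def)

lemma coannihilator_filter:
  assumes "X \<subseteq> carrier L"
  shows "rl_filter L (coannihilator L X)"
  unfolding coannihilator_commuted
proof (rule filterI)
  fix a b assume a: "a \<in> {a \<in> carrier L. \<forall>x\<in>X. x \<squnion> a = \<top>}"
    and b: "b \<in> carrier L" "a \<sqsubseteq> b"
  then have "x \<squnion> b = \<top>" if "x \<in> X" for x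
    using join_eq_topI[of a b x] that assms by blast
  with b show "b \<in> {a \<in> carrier L. \<forall>x\<in>X. x \<squnion> a = \<top>}"
    by simp
qed (use assms in \<open>auto simp: join_tensor_eq_top_iff subset_iff\<close>)

section \<open>Principal filters\<close>

lemma principal_filter_mem: "x \<in> principal_filter L x"
  by (simp add: principal_filter_def)

lemma principal_filter_subset_iff: "rl_filter L F \<Longrightarrow> principal_filter L x \<subseteq> F \<longleftrightarrow> x \<in> F"
  by (auto simp: principal_filter_def)

lemma principal_filter_filter:
  assumes "x \<in> carrier L"
  shows "rl_filter L (principal_filter L x)"
proof (rule filterI)
  show "principal_filter L x \<subseteq> carrier L"
    using assms filter_carrier_self by (auto simp: principal_filter_def)
qed (auto simp: principal_filter_def intro: filter_top filter_tensor filter_upward)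

lemma principal_filter_carrier: "x \<in> carrier L \<Longrightarrow> principal_filter L x \<subseteq> carrier L"
  by (simp add: principal_filter_subset_iff filter_carrier_self)

lemma principal_filter_antimono:
  assumes "x \<sqsubseteq> y" "x \<in> carrier L" "y \<in> carrier L"
  shows "principal_filter L y \<subseteq> principal_filter L x"
  using assms by (meson filter_upward principal_filter_filter principal_filter_mem principal_filter_subset_iff)

lemma principal_filter_top: "principal_filter L \<top> = {\<top>}"
proof
  show "principal_filter L \<top> \<subseteq> {\<top>}"
    by (simp add: principal_filter_subset_iff filter_top_singleton)
qed (simp add: principal_filter_mem)

lemma principal_filter_bottom: "principal_filter L \<bottom> = carrier L"
proof
  show "principal_filter L \<bottom> \<subseteq> carrier L"
    by (simp add: principal_filter_carrier)
  show "carrier L \<subseteq> principal_filter L \<bottom>"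
    using filter_upward[OF principal_filter_filter principal_filter_mem] by blast
qed

text \<open>The filter of all \<open>c\<close> with \<open>a \<squnion> c \<in> F\<close> contains
  \<open>x\<close>, hence all of \<open>principal_filter L x\<close>. This replaces a description of
  the generated filter by powers of \<open>x\<close>.\<close>

lemma join_mem_principal_filter:
  assumes F: "rl_filter L F" and "a \<in> carrier L" "x \<in> carrier L"
    and "a \<squnion> x \<in> F" and "b \<in> principal_filter L x"
  shows "a \<squnion> b \<in> F"
  using principal_filter_subset_iff[OF filter_join_preimage[OF F], of a x] assms by auto

lemma principal_filter_join:
  assumes x: "x \<in> carrier L" and y: "y \<in> carrier L"
  shows "principal_filter L (x \<squnion> y) = principal_filter L x \<inter> principal_filter L y"
proof
  show "principal_filter L (x \<squnion> y) \<subseteq> principal_filter L x \<inter> principal_filter L y"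
    using principal_filter_antimono[of x "x \<squnion> y"] principal_filter_antimono[of y "x \<squnion> y"]
      join_left join_right assms by auto
  show "principal_filter L x \<inter> principal_filter L y \<subseteq> principal_filter L (x \<squnion> y)"
  proof
    fix a assume a: "a \<in> principal_filter L x \<inter> principal_filter L y"
    have ac: "a \<in> carrier L"
      using a x principal_filter_carrier by auto
    have F: "rl_filter L (principal_filter L (x \<squnion> y))"
      using assms by (simp add: principal_filter_filter)
    \<comment> \<open>Starting from \<open>y \<squnion> x\<close>, first \<open>x\<close> and then
      \<open>y\<close> is replaced by \<open>a\<close>, which ends at
      \<open>a \<squnion> a = a\<close>.\<close>
    have "a \<squnion> y \<in> principal_filter L (x \<squnion> y)"
      using join_mem_principal_filter[OF F, of y x a] a x y principal_filter_mem
      by (simp add: join_comm[of L _ y])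
    then show "a \<in> principal_filter L (x \<squnion> y)"
      using join_mem_principal_filter[OF F, of a y a] a ac x y by (simp add: join_idem)
  qed
qed

text \<open>A filter contains \<open>x \<odot> y\<close> iff it contains both factors: by upward
  closure one way, by products the other.\<close>

lemma principal_filter_tensor_subset_iff:
  assumes F: "rl_filter L F" and "x \<in> carrier L" "y \<in> carrier L"
  shows "principal_filter L (x \<odot> y) \<subseteq> F \<longleftrightarrow> principal_filter L x \<subseteq> F \<and> principal_filter L y \<subseteq> F"
  using assms unfolding principal_filter_subset_iff[OF F]
  by (meson filter_tensor filter_upward tensor_closed tensor_le_left tensor_le_right)

section \<open>The lattice of principal filters\<close>

abbreviation PF where "PF \<equiv> principal_filters L"

lemma PF_simps [simp]:
  "carrier PF = principal_filter L ` carrier L" "(\<sqsubseteq>\<^bsub>PF\<^esub>) = (\<subseteq>)" "(.=\<^bsub>PF\<^esub>) = (=)"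
  by (simp_all add: principal_filters_def)

lemma PF_partial_order: "partial_order PF"
  by unfold_locales auto

lemma PF_join_least:
  assumes "x \<in> carrier L" "y \<in> carrier L"
  shows "least PF (principal_filter L (x \<odot> y)) (Upper PF {principal_filter L x, principal_filter L y})"
proof (rule least_UpperI)
  show "z \<sqsubseteq>\<^bsub>PF\<^esub> principal_filter L (x \<odot> y)" if "z \<in> {principal_filter L x, principal_filter L y}" for z
    using that assms principal_filter_antimono[of "x \<odot> y" x] principal_filter_antimono[of "x \<odot> y" y]
      tensor_le_left tensor_le_right by auto
  show "principal_filter L (x \<odot> y) \<sqsubseteq>\<^bsub>PF\<^esub> z"
    if z: "z \<in> Upper PF {principal_filter L x, principal_filter L y}" for z
  proof -
    obtain w where w: "w \<in> carrier L" "z = principal_filter L w"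
      and sub: "principal_filter L x \<subseteq> z" "principal_filter L y \<subseteq> z"
      using z assms unfolding Upper_def by auto
    then show ?thesis
      using assms principal_filter_tensor_subset_iff[OF principal_filter_filter] by simp
  qed
qed (use assms in auto)

lemma PF_meet_greatest:
  assumes "x \<in> carrier L" "y \<in> carrier L"
  shows "greatest PF (principal_filter L (x \<squnion> y)) (Lower PF {principal_filter L x, principal_filter L y})"
proof (rule greatest_LowerI)
  show "principal_filter L (x \<squnion> y) \<sqsubseteq>\<^bsub>PF\<^esub> z" if "z \<in> {principal_filter L x, principal_filter L y}" for z
    using that assms by (auto simp: principal_filter_join)
  show "z \<sqsubseteq>\<^bsub>PF\<^esub> principal_filter L (x \<squnion> y)"
    if "z \<in> Lower PF {principal_filter L x, principal_filter L y}" for z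
    using that assms by (auto simp: Lower_def principal_filter_join)
qed (use assms in auto)

lemma PF_bottom_least: "least PF {\<top>} (carrier PF)"
  unfolding least_def
proof (intro conjI ballI)
  show "{\<top>} \<in> carrier PF"
    using principal_filter_top by force
qed (auto intro: filter_top principal_filter_filter)

lemma PF_top_greatest: "greatest PF (carrier L) (carrier PF)"
  unfolding greatest_def
proof (intro conjI ballI)
  show "carrier L \<in> carrier PF"
    using principal_filter_bottom by force
qed (use principal_filter_carrier in auto)

sublocale PF: bounded_lattice PF
proof -
  interpret partial_order PF by (rule PF_partial_order)
  show "bounded_lattice PF"
  proof unfold_locales
    fix X Y assume "X \<in> carrier PF" "Y \<in> carrier PF"
    then show "\<exists>s. least PF s (Upper PF {X, Y})"
      unfolding PF_simps using PF_join_least by blast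
  next
    fix X Y assume "X \<in> carrier PF" "Y \<in> carrier PF"
    then show "\<exists>s. greatest PF s (Lower PF {X, Y})"
      unfolding PF_simps using PF_meet_greatest by blast
  qed (rule exI, rule PF_bottom_least, rule exI, rule PF_top_greatest)
qed

text \<open>The library join is a choice among least upper bounds; uniqueness identifies it with the
  filter found in \<open>PF_join_least\<close>.\<close>

lemma PF_join:
  assumes "x \<in> carrier L" "y \<in> carrier L"
  shows "principal_filter L x \<squnion>\<^bsub>PF\<^esub> principal_filter L y = principal_filter L (x \<odot> y)"
  unfolding join_def using assms by (intro PF.least_unique[OF PF.sup_of_two_least PF_join_least]) simp_all

lemma PF_meet:
  assumes "x \<in> carrier L" "y \<in> carrier L"
  shows "principal_filter L x \<sqinter>\<^bsub>PF\<^esub> principal_filter L y = principal_filter L (x \<squnion> y)"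
  unfolding meet_def using assms by (intro PF.greatest_unique[OF PF.inf_of_two_greatest PF_meet_greatest]) simp_all

lemma PF_bottom: "\<bottom>\<^bsub>PF\<^esub> = {\<top>}"
  using PF.least_unique PF.bottom_least PF_bottom_least by blast

lemma PF_top: "\<top>\<^bsub>PF\<^esub> = carrier L"
  using PF.greatest_unique PF.top_greatest PF_top_greatest by blast

text \<open>The generators themselves may differ, as for \<open>x = y = z\<close>. The product lies
  below \<open>x \<squnion> y \<odot> z\<close>, and conversely a filter containing
  \<open>x \<squnion> y \<odot> z\<close> contains both factors and hence their product.\<close>

lemma PF_distrib:
  assumes x: "x \<in> carrier L" and y: "y \<in> carrier L" and z: "z \<in> carrier L"
  shows "principal_filter L (x \<squnion> y \<odot> z) = principal_filter L ((x \<squnion> y) \<odot> (x \<squnion> z))"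
proof
  show "principal_filter L (x \<squnion> y \<odot> z) \<subseteq> principal_filter L ((x \<squnion> y) \<odot> (x \<squnion> z))"
    using assms by (intro principal_filter_antimono join_tensor_join_le) simp_all
  have "x \<squnion> y \<odot> z \<sqsubseteq> x \<squnion> y" "x \<squnion> y \<odot> z \<sqsubseteq> x \<squnion> z"
    using assms tensor_le_left[of y z] tensor_le_right[of y z]
    by (auto intro!: join_le intro: join_left join_right le_trans)
  then show "principal_filter L ((x \<squnion> y) \<odot> (x \<squnion> z)) \<subseteq> principal_filter L (x \<squnion> y \<odot> z)"
    using assms by (simp add: principal_filter_tensor_subset_iff principal_filter_filter
        principal_filter_antimono)
qed

text \<open>Distributivity always holds in \<open>PF\<close>, so only complements remain to be
  expressed through generators.\<close>

lemma boolean_lattice_PF_iff: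
  "boolean_lattice PF \<longleftrightarrow>
    (\<forall>x\<in>carrier L. \<exists>y\<in>carrier L. x \<squnion> y = \<top> \<and> principal_filter L (x \<odot> y) = carrier L)"
  (is "_ \<longleftrightarrow> ?complemented")
proof -
  have top_iff: "principal_filter L (x \<squnion> y) = {\<top>} \<longleftrightarrow> x \<squnion> y = \<top>" for x y
    using principal_filter_mem principal_filter_top by fastforce
  have distrib: "X \<sqinter>\<^bsub>PF\<^esub> (Y \<squnion>\<^bsub>PF\<^esub> Z) = (X \<sqinter>\<^bsub>PF\<^esub> Y) \<squnion>\<^bsub>PF\<^esub> (X \<sqinter>\<^bsub>PF\<^esub> Z)"
    if "X \<in> carrier PF" "Y \<in> carrier PF" "Z \<in> carrier PF" for X Y Z
    using that by (auto simp: PF_join PF_meet PF_distrib)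
  have "boolean_lattice_axioms PF \<longleftrightarrow>
      (\<forall>X\<in>carrier PF. \<exists>Y\<in>carrier PF. X \<sqinter>\<^bsub>PF\<^esub> Y = \<bottom>\<^bsub>PF\<^esub> \<and> X \<squnion>\<^bsub>PF\<^esub> Y = \<top>\<^bsub>PF\<^esub>)"
    unfolding boolean_lattice_axioms_def using distrib by blast
  also have "\<dots> \<longleftrightarrow> ?complemented"
    by (simp add: PF_join PF_meet PF_bottom PF_top top_iff cong: ball_cong bex_cong)
  finally have "boolean_lattice_axioms PF \<longleftrightarrow> ?complemented" .
  then show ?thesis
    by (simp add: boolean_lattice_def PF.bounded_lattice_axioms)
qed

section \<open>Coannihilators and complements\<close>

lemma coannihilator_principal_filter:
  assumes x: "x \<in> carrier L"
  shows "coannihilator L (principal_filter L x) = coannihilator L {x}"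
proof
  show "coannihilator L (principal_filter L x) \<subseteq> coannihilator L {x}"
    using principal_filter_mem by (auto simp: coannihilator_def)
  show "coannihilator L {x} \<subseteq> coannihilator L (principal_filter L x)"
  proof
    fix a assume "a \<in> coannihilator L {x}"
    \<comment> \<open>Since \<open>{\<top>}\<close> is a filter, testing the generator
      \<open>x\<close> suffices.\<close>
    then show "a \<in> coannihilator L (principal_filter L x)"
      using join_mem_principal_filter[OF filter_top_singleton, of a x] x
      by (simp add: coannihilator_def)
  qed
qed

lemma coannihilator_complement:
  assumes x: "x \<in> carrier L" and y: "y \<in> carrier L"
    and xy: "x \<squnion> y = \<top>" "principal_filter L (x \<odot> y) = carrier L"
  shows "coannihilator L {x} = principal_filter L y"
proof
  show "principal_filter L y \<subseteq> coannihilator L {x}"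
    using x y xy by (simp add: principal_filter_subset_iff coannihilator_filter)
      (simp add: coannihilator_commuted)
  show "coannihilator L {x} \<subseteq> principal_filter L y"
  proof
    fix a assume "a \<in> coannihilator L {x}"
    then have a: "a \<in> carrier L" and ax: "a \<squnion> x = \<top>"
      by (auto simp: coannihilator_def)
    have F: "rl_filter L (principal_filter L y)"
      using y by (rule principal_filter_filter)
    have "a \<squnion> x \<in> principal_filter L y" "a \<squnion> y \<in> principal_filter L y"
      using ax F filter_top filter_upward[OF F principal_filter_mem, of "a \<squnion> y"] a y join_right
      by simp_all
    \<comment> \<open>The elements whose join with \<open>a\<close> lies in
      \<open>principal_filter L y\<close> form a filter containing \<open>x\<close> and
      \<open>y\<close>.\<close>
    then have "a \<squnion> x \<odot> y \<in> principal_filter L y"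
      using filter_tensor[OF filter_join_preimage[OF F a]] x y by simp
    \<comment> \<open>As \<open>x \<odot> y\<close> generates everything, it may be replaced by
      \<open>\<bottom>\<close>.\<close>
    then have "a \<squnion> \<bottom> \<in> principal_filter L y"
      using join_mem_principal_filter[OF F, of a "x \<odot> y" \<bottom>] a x y xy by simp
    then show "a \<in> principal_filter L y"
      using a by simp
  qed
qed

lemma complemented_if_quasicomplemented:
  assumes "quasicomplemented L" and wd: "weakly_disjunctive L" and x: "x \<in> carrier L"
  obtains y where "y \<in> carrier L" "x \<squnion> y = \<top>" "principal_filter L (x \<odot> y) = carrier L"
proof -
  obtain y where y: "y \<in> carrier L"
    and eq: "coannihilator L (coannihilator L {x}) = coannihilator L {y}"
    using assms by (auto simp: quasicomplemented_def)
  have "x \<in> coannihilator L (coannihilator L {x})"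
    using x by (auto simp: coannihilator_def join_comm[of L x])
  then have xy: "x \<squnion> y = \<top>"
    unfolding eq by (simp add: coannihilator_def)
  \<comment> \<open>Such an \<open>a\<close> lies in the coannihilator of \<open>x\<close> and in
    the double one, so it is orthogonal to itself.\<close>
  have "a = \<top>" if "a \<in> carrier L" "a \<squnion> x \<odot> y = \<top>" for a
  proof -
    have "a \<in> coannihilator L {x}" "a \<in> coannihilator L {y}"
      using that x y by (simp_all add: join_tensor_eq_top_iff coannihilator_def)
    then have "a \<squnion> a = \<top>"
      unfolding eq[symmetric] coannihilator_def[of L "coannihilator L {x}"] by blast
    then show ?thesis
      using that by (simp add: join_idem)
  qed
  then have "coannihilator L {x \<odot> y} = coannihilator L {\<bottom>}"
    using x y by (auto simp: coannihilator_def join_comm[of L \<top>])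
  then have "principal_filter L (x \<odot> y) = carrier L"
    using wd x y unfolding weakly_disjunctive_def
    by (metis bottom_closed principal_filter_bottom tensor_closed)
  with y xy show thesis
    by (rule that)
qed

end

theorem proposition4p4:
  fixes L (structure)
  assumes "residuated_lattice L"
  shows "quasicomplemented L \<and> weakly_disjunctive L \<longleftrightarrow> boolean_lattice (principal_filters L)"
proof -
  interpret residuated_lattice L by (rule assms)
  show ?thesis
    unfolding boolean_lattice_PF_iff
  proof
    assume "quasicomplemented L \<and> weakly_disjunctive L"
    then show "\<forall>x\<in>carrier L. \<exists>y\<in>carrier L. x \<squnion> y = \<top> \<and> principal_filter L (x \<odot> y) = carrier L"
      using complemented_if_quasicomplemented by metis
  next
    assume compl: "\<forall>x\<in>carrier L. \<exists>y\<in>carrier L. x \<squnion> y = \<top> \<and> principal_filter L (x \<odot> y) = carrier L"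
    \<comment> \<open>Being complementary is symmetric in \<open>x\<close> and \<open>y\<close>, so
      \<open>coannihilator_complement\<close> applies both ways.\<close>
    have complement: "\<exists>y\<in>carrier L. coannihilator L {x} = principal_filter L y
      \<and> coannihilator L {y} = principal_filter L x" if x: "x \<in> carrier L" for x
    proof -
      obtain y where "y \<in> carrier L" "x \<squnion> y = \<top>" "principal_filter L (x \<odot> y) = carrier L"
        using compl x by blast
      then show ?thesis
        using x coannihilator_complement[of x y] coannihilator_complement[of y x]
        by (auto simp: join_comm[of L y] tensor_comm[of y])
    qed
    \<comment> \<open>The double coannihilator of \<open>x\<close> is that of
      \<open>principal_filter L y\<close>, hence of \<open>y\<close>.\<close>
    have "quasicomplemented L"
      unfolding quasicomplemented_def using complement coannihilator_principal_filter by metis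
    \<comment> \<open>Now \<open>principal_filter L x\<close> is the double coannihilator of
      \<open>x\<close>, so it is determined by \<open>coannihilator L {x}\<close>.\<close>
    moreover have "weakly_disjunctive L"
      unfolding weakly_disjunctive_def using complement coannihilator_principal_filter by metis
    ultimately show "quasicomplemented L \<and> weakly_disjunctive L" ..
  qed
qed

end
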